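(* No triangle with an angle greater than $2\pi/3$ admits a $k$-splitting gentiling for any $k\ge 3$.
   Context: An $r$-gentiling of a triangle $T$ ($r\ge 2$) is a subdivision of $T$ into $r$ triangles (tiles) with pairwise disjoint interiors, each similar to $T$. For $k\ge2$, a $k$-splitting gentiling of $T$ is a gentiling in which exactly $k$ tiles meet at one of the vertices of $T$. *)

theory Defs
  imports "HOL-Analysis.Analysis"
begin

text \<open>Triangles are non-degenerate, closed and solid. Their vertices, as a property of the
  point set alone, are the extreme points.\<close>

definition triangle_on :: "real^2 \<Rightarrow> real^2 \<Rightarrow> real^2 \<Rightarrow> (real^2) set \<Rightarrow> bool" where
  "triangle_on a b c T \<longleftrightarrow> \<not> collinear {a, b, c} \<and> T = convex hull {a, b, c}"

definition is_triangle :: "(real^2) set \<Rightarrow> bool" where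
  "is_triangle T \<longleftrightarrow> (\<exists>a b c. triangle_on a b c T)"

definition angle_at :: "real^2 \<Rightarrow> real^2 \<Rightarrow> real^2 \<Rightarrow> real" where
  "angle_at a b c = arccos (((a - b) \<bullet> (c - b)) / (norm (a - b) * norm (c - b)))"

definition has_angle :: "(real^2) set \<Rightarrow> real \<Rightarrow> bool" where
  "has_angle T \<phi> \<longleftrightarrow> (\<exists>a b c. triangle_on a b c T \<and> \<phi> = angle_at a b c)"

text \<open>Similarities may reverse orientation.\<close>

definition similar :: "(real^2) set \<Rightarrow> (real^2) set \<Rightarrow> bool" where
  "similar S T \<longleftrightarrow> (\<exists>(f :: real^2 \<Rightarrow> real^2) c. c > 0 \<and>
     (\<forall>x y. dist (f x) (f y) = c * dist x y) \<and> f ` S = T)"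

text \<open>Tilings need not be edge-to-edge.\<close>

definition gentiling :: "nat \<Rightarrow> (real^2) set \<Rightarrow> (real^2) set set \<Rightarrow> bool" where
  "gentiling r T tiles \<longleftrightarrow>
     r \<ge> 2 \<and> is_triangle T \<and> finite tiles \<and> card tiles = r \<and>
     (\<forall>S\<in>tiles. is_triangle S \<and> similar S T) \<and>
     pairwise (\<lambda>S S'. interior S \<inter> interior S' = {}) tiles \<and>
     \<Union>tiles = T"

text \<open>A vertex of \<open>T\<close> is an extreme point of \<open>T\<close>, hence also of each tile containing it.
  So the tiles containing it are the ones having it as a vertex.\<close>

definition splitting_gentiling :: "nat \<Rightarrow> (real^2) set \<Rightarrow> (real^2) set set \<Rightarrow> bool" where
  "splitting_gentiling k T tiles \<longleftrightarrow>
     k \<ge> 2 \<and> (\<exists>r. gentiling r T tiles) \<and>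
     (\<exists>v. v extreme_point_of T \<and> card {S \<in> tiles. v \<in> S} = k)"

end

theory Submission
  imports Defs
begin

text \<open>Measure angles in units of \<open>\<pi>\<close> and let \<open>\<alpha> \<le> \<beta> < \<gamma>\<close> be those of \<open>T\<close>, so \<open>\<gamma> > 2 / 3\<close>.
  At a point \<open>p\<close> that is a vertex of some tile but not of \<open>T\<close>, the tile angles with apex \<open>p\<close> sum to
  \<open>m p \<in> {1, 2}\<close>, and at most \<open>m p\<close> of them are \<open>\<gamma>\<close>. With \<open>r\<close> tiles, comparing angle sums gives
  \<open>\<Sum>m p = r - 1\<close>. As \<open>r\<close> angles \<open>\<gamma>\<close> must be placed, the \<open>\<gamma>\<close>-vertex of \<open>T\<close> is not split, and there are
  exactly \<open>m p\<close> angles \<open>\<gamma>\<close> at each \<open>p\<close>. Splitting the vertex of angle \<open>\<beta>\<close> into at least three parts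
  forces \<open>\<beta> \<ge> 3 * \<alpha>\<close>; then the remaining \<open>m p * (\<alpha> + \<beta>)\<close> at \<open>p\<close> has room for at most \<open>m p\<close> angles \<open>\<beta>\<close>,
  and none occurs at the vertices of \<open>T\<close>, so at most \<open>r - 1\<close> of the \<open>r\<close> angles \<open>\<beta>\<close> are accounted for.\<close>

subsection \<open>Planar cones and their apertures\<close>

definition cross2 :: "real^2 \<Rightarrow> real^2 \<Rightarrow> real" where
  "cross2 u w = u $ 1 * w $ 2 - u $ 2 * w $ 1"

lemma cross2_simps [simp]:
  "cross2 u u = 0" "cross2 (- u) w = - cross2 u w" "cross2 u (- w) = - cross2 u w"
  "cross2 (c *\<^sub>R u) w = c * cross2 u w" "cross2 u (c *\<^sub>R w) = c * cross2 u w"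
  "cross2 (u + v) w = cross2 u w + cross2 v w" "cross2 u (v + w) = cross2 u v + cross2 u w"
  "cross2 (u - v) w = cross2 u w - cross2 v w" "cross2 u (v - w) = cross2 u v - cross2 u w"
  by (simp_all add: cross2_def algebra_simps)

lemma cross2_commute: "cross2 w u = - cross2 u w"
  by (simp add: cross2_def)

lemma cramer2:
  assumes "cross2 u w \<noteq> 0"
  shows "d = (cross2 d w / cross2 u w) *\<^sub>R u + (cross2 u d / cross2 u w) *\<^sub>R w"
proof -
  have "cross2 u w * d $ i = cross2 d w * u $ i + cross2 u d * w $ i" for i
    using exhaust_2[of i] by (auto simp: cross2_def algebra_simps)
  then have "d $ i = (cross2 d w * u $ i + cross2 u d * w $ i) / cross2 u w" for i
    using assms by (simp add: nonzero_eq_divide_eq mult.commute)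
  then show ?thesis
    by (simp add: vec_eq_iff add_divide_distrib)
qed

lemma cramer2E:
  assumes "cross2 u w \<noteq> 0"
  obtains x y where "d = x *\<^sub>R u + y *\<^sub>R w"
  using cramer2[OF assms] by blast

lemma cramer2_unique:
  assumes "cross2 u w \<noteq> 0"
  shows "x *\<^sub>R u + y *\<^sub>R w = x' *\<^sub>R u + y' *\<^sub>R w \<longleftrightarrow> x = x' \<and> y = y'"
proof
  assume e: "x *\<^sub>R u + y *\<^sub>R w = x' *\<^sub>R u + y' *\<^sub>R w"
  have "x * cross2 u w = x' * cross2 u w" "y * cross2 u w = y' * cross2 u w"
    using arg_cong[OF e, of "\<lambda>d. cross2 d w"] arg_cong[OF e, of "cross2 u"] by simp_all
  then show "x = x' \<and> y = y'" using assms by simp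
qed simp

lemma collinear_iff_cross2: "collinear {a, b, c} \<longleftrightarrow> cross2 (b - a) (c - a) = 0"
proof -
  have "collinear {a, b, c} \<longleftrightarrow> collinear {0, b - a, c - a}"
    using collinear_3[of b a c] by (simp add: collinear_def insert_commute)
  also have "\<dots> \<longleftrightarrow> cross2 (b - a) (c - a) = 0"
  proof
    assume "collinear {0, b - a, c - a}"
    then show "cross2 (b - a) (c - a) = 0"
      unfolding collinear_lemma by (auto simp del: cross2_simps(8,9)) (auto simp: cross2_def)
  next
    assume z: "cross2 (b - a) (c - a) = 0"
    define u w where "u = b - a" and "w = c - a"
    have z: "u $ 1 * w $ 2 = u $ 2 * w $ 1" using z by (simp add: u_def w_def cross2_def)
    \<comment> \<open>The multiplier is read off from whichever coordinate of \<open>u\<close> is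
      nonzero; the vanishing determinant makes the other coordinate agree.\<close>
    have "\<exists>k. w = k *\<^sub>R u" if "u \<noteq> 0"
    proof (cases "u $ 1 = 0")
      case True
      then have "u $ 2 \<noteq> 0" using that by (simp add: vec_eq_iff forall_2)
      then show ?thesis using z True
        by (intro exI[of _ "w $ 2 / u $ 2"]) (simp add: vec_eq_iff forall_2)
    next
      case False
      then show ?thesis using z
        by (intro exI[of _ "w $ 1 / u $ 1"]) (simp add: vec_eq_iff forall_2 field_simps)
    qed
    then show "collinear {0, b - a, c - a}"
      unfolding collinear_lemma u_def w_def by blast
  qed
  finally show ?thesis .
qed

text \<open>The set is the line spanned by \<open>u\<close>, a hyperplane whose normal
  \<open>a\<close> is \<open>u\<close> turned by a right angle. Overlaps of adjacent cones will be
  put inside such lines.\<close>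

lemma negligible_cross2: "u \<noteq> 0 \<Longrightarrow> negligible {d. cross2 u d = 0}"
proof -
  assume u: "u \<noteq> 0"
  define a :: "real^2" where "a = vector [- u $ 2, u $ 1]"
  have "{d. cross2 u d = 0} = {d. a \<bullet> d = 0}"
    by (auto simp: cross2_def a_def inner_vec_def sum_2)
  moreover have "a \<noteq> 0" using u by (auto simp: a_def vec_eq_iff forall_2)
  ultimately show ?thesis by (simp add: negligible_hyperplane)
qed

section \<open>Convex cones spanned by two vectors\<close>

definition cone2 :: "real^2 \<Rightarrow> real^2 \<Rightarrow> (real^2) set" where
  "cone2 u w = {x *\<^sub>R u + y *\<^sub>R w | x y. 0 \<le> x \<and> 0 \<le> y}"

lemma cone2_commute: "cone2 u w = cone2 w u"
proof -
  have "cone2 u w \<subseteq> cone2 w u" for u w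
    unfolding cone2_def using add.commute by blast
  then show ?thesis by blast
qed

lemma mem_cone2_iff:
  assumes "cross2 u w \<noteq> 0"
  shows "x *\<^sub>R u + y *\<^sub>R w \<in> cone2 u w \<longleftrightarrow> 0 \<le> x \<and> 0 \<le> y"
  unfolding cone2_def mem_Collect_eq cramer2_unique[OF assms] by blast

lemma convex_cone2: "convex (cone2 u w)"
proof (rule convexI)
  fix d e and s t :: real
  assume "d \<in> cone2 u w" "e \<in> cone2 u w" and st: "0 \<le> s" "0 \<le> t" "s + t = 1"
  then obtain x y x' y' where "d = x *\<^sub>R u + y *\<^sub>R w" "e = x' *\<^sub>R u + y' *\<^sub>R w"
    and nn: "0 \<le> x" "0 \<le> y" "0 \<le> x'" "0 \<le> y'"
    unfolding cone2_def by blast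
  then have "s *\<^sub>R d + t *\<^sub>R e = (s * x + t * x') *\<^sub>R u + (s * y + t * y') *\<^sub>R w"
    by (simp add: algebra_simps)
  then show "s *\<^sub>R d + t *\<^sub>R e \<in> cone2 u w"
    using nn st unfolding cone2_def by (auto intro!: exI)
qed

lemma cone2_scaleR:
  assumes "0 < s" "0 < t"
  shows "cone2 (s *\<^sub>R u) (t *\<^sub>R w) = cone2 u w"
proof -
  have "\<exists>x' y'. x *\<^sub>R u + y *\<^sub>R w = x' *\<^sub>R s *\<^sub>R u + y' *\<^sub>R t *\<^sub>R w \<and> 0 \<le> x' \<and> 0 \<le> y'"
    if "0 \<le> x" "0 \<le> y" for x y
    using that assms by (intro exI[of _ "x / s"] exI[of _ "y / t"]) auto
  moreover have "\<exists>x' y'. x *\<^sub>R s *\<^sub>R u + y *\<^sub>R t *\<^sub>R w = x' *\<^sub>R u + y' *\<^sub>R w \<and> 0 \<le> x' \<and> 0 \<le> y'"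
    if "0 \<le> x" "0 \<le> y" for x y
    using that assms by (intro exI[of _ "x * s"] exI[of _ "y * t"]) auto
  ultimately show ?thesis
    unfolding cone2_def by blast
qed

lemma cone2_linear_image:
  assumes "linear f"
  shows "f ` cone2 u w = cone2 (f u) (f w)"
proof -
  have "f (x *\<^sub>R u + y *\<^sub>R w) = x *\<^sub>R f u + y *\<^sub>R f w" for x y
    using assms by (simp add: linear_add linear_scale)
  then show ?thesis
    unfolding cone2_def by (auto simp: image_iff) metis
qed

text \<open>Angles are measured by sector area, normalised so that a straight angle is 1.\<close>

definition aperture :: "(real^2) set \<Rightarrow> real" where
  "aperture K = 2 * measure lebesgue (K \<inter> ball 0 1) / measure lebesgue (ball (0 :: real^2) 1)"

text \<open>Bounded convex sets are Lebesgue measurable. This is why convexity accompanies the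
  additivity and invariance facts below.\<close>

lemma lmeasurable_Int_ball: "convex K \<Longrightarrow> K \<inter> ball (0 :: real^2) 1 \<in> lmeasurable"
  by (intro measurable_convex convex_Int bounded_Int) auto

lemma unit_disc_area_pos: "0 < measure lebesgue (ball (0 :: real^2) 1)"
  using content_ball_pos[of 1 "0 :: real^2"] by simp

lemma aperture_empty [simp]: "aperture {} = 0"
  by (simp add: aperture_def)

lemma aperture_UNIV [simp]: "aperture UNIV = 2"
  using unit_disc_area_pos by (simp add: aperture_def)

lemma aperture_Union:
  assumes "finite I" "\<And>i. i \<in> I \<Longrightarrow> convex (K i)"
    and "\<And>i j. i \<in> I \<Longrightarrow> j \<in> I \<Longrightarrow> i \<noteq> j \<Longrightarrow> negligible (K i \<inter> K j)"
  shows "aperture (\<Union>i\<in>I. K i) = (\<Sum>i\<in>I. aperture (K i))"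
proof -
  have "measure lebesgue (\<Union>i\<in>I. K i \<inter> ball 0 1) = (\<Sum>i\<in>I. measure lebesgue (K i \<inter> ball 0 1))"
  proof (rule measure_negligible_finite_Union_image)
    show "pairwise (\<lambda>i j. negligible (K i \<inter> ball 0 1 \<inter> (K j \<inter> ball 0 1))) I"
      unfolding pairwise_def using assms(3) by (meson Int_mono Int_lower1 negligible_subset)
  qed (use assms lmeasurable_Int_ball in auto)
  moreover have "(\<Union>i\<in>I. K i \<inter> ball 0 1) = (\<Union>i\<in>I. K i) \<inter> ball 0 1" by auto
  ultimately show ?thesis
    by (simp add: aperture_def sum_distrib_left sum_divide_distrib)
qed

lemma aperture_Un:
  assumes "convex K" "convex L" "negligible (K \<inter> L)"
  shows "aperture (K \<union> L) = aperture K + aperture L"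
  \<comment> \<open>Indexing by booleans rather than by the set \<open>{K, L}\<close> covers the
    case \<open>K = L\<close> as well.\<close>
  using aperture_Union[of "{True, False}" "\<lambda>b. if b then K else L"] assms
  by (simp add: Int_commute Un_commute)

text \<open>Orthogonal maps preserve both the unit disc and area.\<close>

lemma aperture_orthogonal_image:
  assumes "orthogonal_transformation f" "convex K"
  shows "aperture (f ` K) = aperture K"
proof -
  have "f ` (K \<inter> ball 0 1) = f ` K \<inter> ball 0 1"
    using image_orthogonal_transformation_ball[OF assms(1), of 0 1]
      orthogonal_transformation_inj[OF assms(1)] orthogonal_transformation_linear[OF assms(1)]
    by (simp add: image_Int linear_0)
  then show ?thesis
    using measure_orthogonal_image[OF assms(1) lmeasurable_Int_ball[OF assms(2)]]
    by (simp add: aperture_def)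
qed

lemma aperture_cone2_orthogonal:
  assumes "orthogonal_transformation f"
  shows "aperture (cone2 (f u) (f w)) = aperture (cone2 u w)"
  using aperture_orthogonal_image[OF assms convex_cone2]
  by (simp add: cone2_linear_image orthogonal_transformation_linear[OF assms])

lemma aperture_cone2_uminus: "aperture (cone2 (- u) (- w)) = aperture (cone2 u w)"
  by (rule aperture_cone2_orthogonal) (simp add: orthogonal_transformation_neg[of "\<lambda>x. x"])

text \<open>The ray along \<open>m\<close> runs strictly inside the cone and cuts it into two cones
  that meet only along that ray.\<close>

lemma aperture_cone2_add:
  assumes c: "cross2 u w \<noteq> 0" and pq: "0 < p" "0 < q" and m: "m = p *\<^sub>R u + q *\<^sub>R w"
  shows "aperture (cone2 u w) = aperture (cone2 u m) + aperture (cone2 m w)"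
proof -
  have "negligible (cone2 u m \<inter> cone2 m w)"
  proof (rule negligible_subset[OF negligible_cross2])
    show "m \<noteq> 0" using cramer2_unique[OF c, of p q 0 0] pq m by auto
    show "cone2 u m \<inter> cone2 m w \<subseteq> {d. cross2 m d = 0}"
    proof clarify
      fix d assume "d \<in> cone2 u m" "d \<in> cone2 m w"
      then obtain x y x' y' where d: "d = x *\<^sub>R u + y *\<^sub>R m" "d = x' *\<^sub>R m + y' *\<^sub>R w"
        and nn: "0 \<le> x" "0 \<le> y'"
        unfolding cone2_def by blast
      \<comment> \<open>The two expansions of \<open>d\<close> give \<open>cross2 m d\<close>
        opposite signs relative to \<open>cross2 u w\<close>, so it vanishes.\<close>
      have "cross2 m d = - (x * q) * cross2 u w"
        unfolding d(1) by (simp add: m cross2_commute[of w u] algebra_simps)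
      moreover have "cross2 m d = (y' * p) * cross2 u w"
        unfolding d(2) by (simp add: m cross2_commute[of w u] algebra_simps)
      ultimately have "(y' * p + x * q) * cross2 u w = 0" by (simp add: algebra_simps)
      then have "y' * p + x * q = 0" using c by simp
      then have "y' * p = 0" using nn pq by (simp add: add_nonneg_eq_0_iff)
      then show "cross2 m d = 0" using \<open>cross2 m d = (y' * p) * cross2 u w\<close> by simp
    qed
  qed
  moreover have "cone2 u w = cone2 u m \<union> cone2 m w"
  proof (intro equalityI subsetI)
    fix d assume "d \<in> cone2 u w"
    then obtain x y where d: "d = x *\<^sub>R u + y *\<^sub>R w" and nn: "0 \<le> x" "0 \<le> y"
      unfolding cone2_def by blast
    show "d \<in> cone2 u m \<union> cone2 m w"
    \<comment> \<open>Comparing the two ratios decides on which side of the ray along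
      \<open>m\<close> the vector \<open>d\<close> lies.\<close>
    proof (cases "y / q \<le> x / p")
      case True
      have "d = (x - y / q * p) *\<^sub>R u + (y / q) *\<^sub>R m"
        using pq by (simp add: d m algebra_simps)
      moreover have "0 \<le> x - y / q * p" using True pq by (simp add: field_simps)
      ultimately show ?thesis using nn pq unfolding cone2_def by (auto intro!: exI)
    next
      case False
      have "d = (x / p) *\<^sub>R m + (y - x / p * q) *\<^sub>R w"
        using pq by (simp add: d m algebra_simps)
      moreover have "0 \<le> y - x / p * q" using False pq by (simp add: field_simps)
      ultimately show ?thesis using nn pq unfolding cone2_def by (auto intro!: exI)
    qed
  next
    fix d assume "d \<in> cone2 u m \<union> cone2 m w"
    then consider x y where "d = (x + y * p) *\<^sub>R u + (y * q) *\<^sub>R w" "0 \<le> x" "0 \<le> y"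
      | x y where "d = (x * p) *\<^sub>R u + (x * q + y) *\<^sub>R w" "0 \<le> x" "0 \<le> y"
      unfolding cone2_def by (auto simp: m algebra_simps)
    then show "d \<in> cone2 u w"
      by cases (use pq in \<open>auto simp: cone2_def intro!: exI\<close>)
  qed
  ultimately show ?thesis by (simp add: aperture_Un convex_cone2)
qed

text \<open>For independent \<open>u\<close> and \<open>w\<close>, the line spanned by
  \<open>u\<close> is the boundary and \<open>w\<close> only selects the side.\<close>

definition hplane :: "real^2 \<Rightarrow> real^2 \<Rightarrow> (real^2) set" where
  "hplane u w = {x *\<^sub>R u + y *\<^sub>R w | x y. 0 \<le> y}"

lemma hplaneI: "0 \<le> y \<Longrightarrow> x *\<^sub>R u + y *\<^sub>R w \<in> hplane u w"
  unfolding hplane_def by blast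

lemma mem_hplane_iff:
  assumes "cross2 u w \<noteq> 0"
  shows "x *\<^sub>R u + y *\<^sub>R w \<in> hplane u w \<longleftrightarrow> 0 \<le> y"
  unfolding hplane_def mem_Collect_eq cramer2_unique[OF assms] by blast

lemma hplane_eq: "hplane u w = cone2 u w \<union> cone2 w (- u)"
proof -
  have "\<exists>x' y'. x *\<^sub>R u + y *\<^sub>R w = x' *\<^sub>R w + y' *\<^sub>R - u \<and> 0 \<le> x' \<and> 0 \<le> y'"
    if "\<not> 0 \<le> x" "0 \<le> y" for x y
    using that by (intro exI[of _ y] exI[of _ "- x"]) auto
  moreover have "\<exists>x' y'. x *\<^sub>R w + y *\<^sub>R - u = x' *\<^sub>R u + y' *\<^sub>R w \<and> 0 \<le> y'"
    if "0 \<le> x" for x y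
    using that by (intro exI[of _ "- y"] exI[of _ x]) auto
  ultimately show ?thesis
    unfolding hplane_def cone2_def by blast
qed

text \<open>A half-turn carries the half-plane to the opposite one; together they cover the plane
  and overlap in a line, so each has half of the full aperture 2. The ray along \<open>w\<close>
  then cuts the half-plane into two supplementary angles.\<close>

lemma aperture_hplane:
  assumes c: "cross2 u w \<noteq> 0"
  shows "aperture (hplane u w) = 1"
    and "aperture (cone2 u w) + aperture (cone2 w (- u)) = 1"
proof -
  have conv: "convex (hplane u w')" for w'
  proof (rule convexI)
    fix d e and s t :: real
    assume "d \<in> hplane u w'" "e \<in> hplane u w'" and st: "0 \<le> s" "0 \<le> t" "s + t = 1"
    then obtain x y x' y' where "d = x *\<^sub>R u + y *\<^sub>R w'" "e = x' *\<^sub>R u + y' *\<^sub>R w'"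
      and nn: "0 \<le> y" "0 \<le> y'"
      unfolding hplane_def by blast
    then have "s *\<^sub>R d + t *\<^sub>R e = (s * x + t * x') *\<^sub>R u + (s * y + t * y') *\<^sub>R w'"
      by (simp add: algebra_simps)
    then show "s *\<^sub>R d + t *\<^sub>R e \<in> hplane u w'"
      using nn st unfolding hplane_def by (auto intro!: exI)
  qed
  have u: "u \<noteq> 0" "w \<noteq> 0" using c by (auto simp: cross2_def)
  have im: "uminus ` hplane u w = hplane u (- w)"
  proof -
    have "- (x *\<^sub>R u + y *\<^sub>R w) = (- x) *\<^sub>R u + y *\<^sub>R - w" for x y by simp
    moreover have "x *\<^sub>R u + y *\<^sub>R - w = - ((- x) *\<^sub>R u + y *\<^sub>R w)" for x y by simp
    ultimately show ?thesis unfolding hplane_def image_def by blast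
  qed
  have "orthogonal_transformation (uminus :: real^2 \<Rightarrow> real^2)"
    using orthogonal_transformation_neg[of "\<lambda>x :: real^2. x"] by simp
  then have "aperture (hplane u (- w)) = aperture (hplane u w)"
    using aperture_orthogonal_image[OF _ conv, of uminus w] im by simp
  moreover have "hplane u w \<union> hplane u (- w) = UNIV"
  proof -
    have "d \<in> hplane u w \<union> hplane u (- w)" for d
    proof -
      obtain x y where d: "d = x *\<^sub>R u + y *\<^sub>R w" using cramer2E[OF c] by blast
      have e: "(- y) *\<^sub>R - w = y *\<^sub>R w" by simp
      show ?thesis
      proof (cases "0 \<le> y")
        case True
        then show ?thesis using hplaneI[of y x u w] d by simp
      next
        case False
        then have "x *\<^sub>R u + (- y) *\<^sub>R - w \<in> hplane u (- w)" by (intro hplaneI) simp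
        then show ?thesis unfolding e d by simp
      qed
    qed
    then show ?thesis by blast
  qed
  moreover have "negligible (hplane u w \<inter> hplane u (- w))"
  proof (rule negligible_subset[OF negligible_cross2[OF u(1)]], clarify)
    fix d assume "d \<in> hplane u w" "d \<in> hplane u (- w)"
    then obtain x y x' y' where d: "d = x *\<^sub>R u + y *\<^sub>R w" "d = x' *\<^sub>R u + y' *\<^sub>R - w"
      and nn: "0 \<le> y" "0 \<le> y'"
      unfolding hplane_def by blast
    have "x *\<^sub>R u + y *\<^sub>R w = x' *\<^sub>R u + (- y') *\<^sub>R w"
      using d by (simp add: d(1)[symmetric])
    then have "y = - y'" unfolding cramer2_unique[OF c] by blast
    then have "y = 0" using nn by simp
    then show "cross2 u d = 0" by (simp add: d(1))
  qed
  ultimately have "aperture (UNIV :: (real^2) set) = 2 * aperture (hplane u w)"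
    using aperture_Un[OF conv[of w] conv[of "- w"]] by simp
  then show 1: "aperture (hplane u w) = 1" by simp
  have "negligible (cone2 u w \<inter> cone2 w (- u))"
  proof (rule negligible_subset[OF negligible_cross2[OF u(2)]], clarify)
    fix d assume "d \<in> cone2 u w" "d \<in> cone2 w (- u)"
    then obtain x y x' y' where d: "d = x *\<^sub>R u + y *\<^sub>R w" "d = x' *\<^sub>R w + y' *\<^sub>R - u"
      and nn: "0 \<le> x" "0 \<le> y'"
      unfolding cone2_def by blast
    have "x *\<^sub>R u + y *\<^sub>R w = (- y') *\<^sub>R u + x' *\<^sub>R w"
      using d by (simp add: d(1)[symmetric])
    then have "x = - y'" unfolding cramer2_unique[OF c] by blast
    then have "x = 0" using nn by simp
    then show "cross2 w d = 0" by (simp add: d(1))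
  qed
  then show "aperture (cone2 u w) + aperture (cone2 w (- u)) = 1"
    using 1 by (simp add: hplane_eq aperture_Un convex_cone2)
qed

text \<open>A convex set of area zero has empty interior and hence lies in a line. The part of the
  cone in the disc contains 0 and short multiples of the independent vectors \<open>u\<close> and
  \<open>w\<close>, so it does not.\<close>

lemma aperture_cone2_pos:
  assumes c: "cross2 u w \<noteq> 0"
  shows "0 < aperture (cone2 u w)"
proof -
  define x where "x = u + w"
  have ne: "interior (cone2 u w \<inter> ball 0 1) \<noteq> {}"
  proof
    assume "interior (cone2 u w \<inter> ball 0 1) = {}"
    then obtain a b where a: "a \<noteq> 0" and sub: "cone2 u w \<inter> ball 0 1 \<subseteq> {x. a \<bullet> x = b}"
      using empty_interior_subset_hyperplane convex_Int[OF convex_cone2 convex_ball] by metis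
    have b: "b = 0"
    proof -
      have "(0 :: real^2) = 0 *\<^sub>R u + 0 *\<^sub>R w" by simp
      then have "0 \<in> cone2 u w" unfolding cone2_def by blast
      then show ?thesis using sub by auto
    qed
    have *: "a \<bullet> v = 0" if v: "v \<in> {u, w}" for v
    proof -
      define t where "t = 1 / (2 * (norm v + 1))"
      have t: "0 < t" "norm (t *\<^sub>R v) < 1"
        using norm_ge_zero[of v] by (auto simp: t_def field_simps simp del: norm_ge_zero)
      have "t *\<^sub>R u = t *\<^sub>R u + 0 *\<^sub>R w" "t *\<^sub>R w = 0 *\<^sub>R u + t *\<^sub>R w" by simp_all
      then have "t *\<^sub>R v \<in> cone2 u w" using v t(1) unfolding cone2_def
        by (smt (verit, best) insert_iff mem_Collect_eq singletonD)
      then have "a \<bullet> (t *\<^sub>R v) = 0" using sub t b by auto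
      then show ?thesis using t by simp
    qed
    \<comment> \<open>The normal \<open>a\<close> is orthogonal to both basis vectors and therefore
      to itself.\<close>
    obtain x y where "a = x *\<^sub>R u + y *\<^sub>R w" using cramer2E[OF c] by blast
    then have "a \<bullet> a = x * (a \<bullet> u) + y * (a \<bullet> w)" by (metis inner_add_right inner_scaleR_right)
    then show False using * a by simp
  qed
  have "measure lebesgue (cone2 u w \<inter> ball 0 1) \<noteq> 0"
    using ne negligible_convex_interior lmeasurable_Int_ball[OF convex_cone2]
    by (metis convex_Int convex_ball convex_cone2 negligible_iff_measure0)
  then show ?thesis
    using unit_disc_area_pos by (simp add: aperture_def zero_less_measure_iff)
qed

text \<open>The apex is the middle argument, as in \<open>angle_at\<close>.\<close>

definition aperture_at :: "real^2 \<Rightarrow> real^2 \<Rightarrow> real^2 \<Rightarrow> real" where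
  "aperture_at a b c = aperture (cone2 (a - b) (c - b))"

lemma aperture_at_commute: "aperture_at a b c = aperture_at c b a"
  by (simp add: aperture_at_def cone2_commute)

lemma aperture_at_pos:
  assumes "\<not> collinear {a, b, c}"
  shows "0 < aperture_at a b c"
proof -
  have "\<not> collinear {b, a, c}" using assms by (simp add: insert_commute)
  then show ?thesis
    unfolding aperture_at_def collinear_iff_cross2 by (rule aperture_cone2_pos)
qed

text \<open>The classical argument with a parallel to the opposite side: the direction
  \<open>w - u\<close> of that side splits the supplement of the angle at \<open>a\<close> into a
  copy of the angle at \<open>b\<close> and, up to a half-turn, the angle at
  \<open>c\<close>.\<close>

lemma aperture_at_sum:
  assumes "\<not> collinear {a, b, c}"
  shows "aperture_at b a c + aperture_at a b c + aperture_at a c b = 1"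
proof -
  define u w where "u = b - a" and "w = c - a"
  have c: "cross2 u w \<noteq> 0" using assms by (simp add: collinear_iff_cross2 u_def w_def)
  have "aperture (cone2 u w) + aperture (cone2 w (- u)) = 1"
    by (rule aperture_hplane(2)[OF c])
  moreover have "aperture (cone2 w (- u)) = aperture (cone2 w (w - u)) + aperture (cone2 (w - u) (- u))"
    by (rule aperture_cone2_add[of _ _ 1 1]) (use c cross2_commute[of w u] in simp_all)
  moreover have "aperture (cone2 w (w - u)) = aperture (cone2 (- w) (u - w))"
    using aperture_cone2_uminus[of w "w - u"] by simp
  moreover have e: "c - b = w - u" "a - b = - u" "a - c = - w" "b - c = u - w"
    by (simp_all add: u_def w_def)
  have "aperture_at b a c = aperture (cone2 u w)" "aperture_at a c b = aperture (cone2 (- w) (u - w))"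
    by (simp_all only: aperture_at_def e u_def[symmetric] w_def[symmetric])
  moreover have "aperture_at a b c = aperture (cone2 (w - u) (- u))"
    unfolding aperture_at_def e by (rule arg_cong[OF cone2_commute])
  ultimately show ?thesis by linarith
qed

subsection \<open>Germs of triangles\<close>

text \<open>The cone of directions in which one can leave \<open>p\<close> while staying in
  \<open>S\<close> for a short while. The zero direction belongs to it exactly if \<open>p\<close>
  lies in \<open>S\<close>.\<close>

definition germ :: "(real^2) set \<Rightarrow> real^2 \<Rightarrow> (real^2) set" where
  "germ S p = {d. \<forall>\<^sub>F t in at_right 0. p + t *\<^sub>R d \<in> S}"

lemma convex_germ:
  assumes "convex S"
  shows "convex (germ S p)"
proof (rule convexI)
  fix d e and x y :: real
  assume "d \<in> germ S p" "e \<in> germ S p" and xy: "0 \<le> x" "0 \<le> y" "x + y = 1"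
  then have "\<forall>\<^sub>F t in at_right 0. p + t *\<^sub>R d \<in> S \<and> p + t *\<^sub>R e \<in> S"
    by (simp add: germ_def eventually_conj)
  then have "\<forall>\<^sub>F t in at_right 0. p + t *\<^sub>R (x *\<^sub>R d + y *\<^sub>R e) \<in> S"
  proof (rule eventually_mono)
    fix t assume "p + t *\<^sub>R d \<in> S \<and> p + t *\<^sub>R e \<in> S"
    then have "x *\<^sub>R (p + t *\<^sub>R d) + y *\<^sub>R (p + t *\<^sub>R e) \<in> S"
      using convexD[OF assms] xy by blast
    moreover have "x *\<^sub>R (p + t *\<^sub>R d) + y *\<^sub>R (p + t *\<^sub>R e)
        = (x + y) *\<^sub>R p + t *\<^sub>R (x *\<^sub>R d + y *\<^sub>R e)"
      by (simp add: algebra_simps)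
    ultimately show "p + t *\<^sub>R (x *\<^sub>R d + y *\<^sub>R e) \<in> S"
      by (simp add: xy(3))
  qed
  then show "x *\<^sub>R d + y *\<^sub>R e \<in> germ S p" by (simp add: germ_def)
qed

lemma germ_Int: "germ S p \<inter> germ S' p = germ (S \<inter> S') p"
  by (auto simp: germ_def eventually_conj_iff)

text \<open>A convex set without interior lies in a line, so all its directions are parallel to that
  line. This is applied to the intersection of two tiles.\<close>

lemma negligible_germ:
  assumes "convex S" "interior S = {}"
  shows "negligible (germ S p)"
proof -
  obtain a b where a: "a \<noteq> 0" and S: "S \<subseteq> {x. a \<bullet> x = b}"
    using empty_interior_subset_hyperplane[OF assms] .
  have "germ S p \<subseteq> {d. a \<bullet> d = 0}"
  proof clarify
    fix d assume "d \<in> germ S p"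
    then have "\<forall>\<^sub>F t in at_right (0 :: real). p + t *\<^sub>R d \<in> S" by (simp add: germ_def)
    then obtain h where h: "0 < h" "\<And>t. 0 < t \<Longrightarrow> t < h \<Longrightarrow> p + t *\<^sub>R d \<in> S"
      unfolding eventually_at_right_field by blast
    \<comment> \<open>Two different parameters are used to eliminate \<open>a \<bullet> p\<close>
      and \<open>b\<close>.\<close>
    have "a \<bullet> (p + (h / 2) *\<^sub>R d) = b" "a \<bullet> (p + (h / 3) *\<^sub>R d) = b"
      using S h(2)[of "h / 2"] h(2)[of "h / 3"] h(1) by auto
    then have "h / 2 * (a \<bullet> d) = h / 3 * (a \<bullet> d)"
      unfolding inner_add_right inner_scaleR_right by linarith
    then show "a \<bullet> d = 0" using h(1) by simp
  qed
  then show ?thesis using negligible_hyperplane a negligible_subset by blast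
qed

text \<open>The points \<open>p + t *\<^sub>R d\<close> tend to \<open>p\<close>. The weak form with
  \<open>\<exists>\<^sub>F\<close> is what a pigeonhole argument over finitely many sets
  provides.\<close>

lemma frequently_closed_point:
  fixes p d :: "real^2"
  assumes "closed S" "\<exists>\<^sub>F t in at_right (0 :: real). p + t *\<^sub>R d \<in> S"
  shows "p \<in> S"
proof (rule ccontr)
  assume "p \<notin> S"
  have "((\<lambda>t. p + t *\<^sub>R d) \<longlongrightarrow> p + 0 *\<^sub>R d) (at_right (0 :: real))"
    by (intro tendsto_intros)
  then have "\<forall>\<^sub>F t in at_right (0 :: real). p + t *\<^sub>R d \<in> - S"
    using topological_tendstoD[of "\<lambda>t. p + t *\<^sub>R d" p "at_right 0" "- S"] assms(1) \<open>p \<notin> S\<close>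
    by (simp add: open_Compl)
  then show False using assms(2) by (simp add: frequently_def)
qed

lemma germ_outside: "closed S \<Longrightarrow> p \<notin> S \<Longrightarrow> germ S p = {}"
  using frequently_closed_point[of S p] eventually_frequently[OF trivial_limit_at_right_real]
  unfolding germ_def by blast

text \<open>By pigeonhole, one of the finitely many sets meets the ray arbitrarily close to
  \<open>p\<close>. It contains \<open>p\<close> since it is closed, and by convexity it then
  contains a whole initial segment of the ray.\<close>

lemma germ_Union:
  assumes "finite F" and F: "\<And>S. S \<in> F \<Longrightarrow> closed S" "\<And>S. S \<in> F \<Longrightarrow> convex S"
  shows "germ (\<Union>F) p = (\<Union>S\<in>F. germ S p)"
proof (intro equalityI subsetI)
  fix d assume "d \<in> germ (\<Union>F) p"
  then have ev: "\<forall>\<^sub>F t in at_right (0 :: real). \<exists>S\<in>F. p + t *\<^sub>R d \<in> S" by (simp add: germ_def)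
  have "\<exists>S\<in>F. \<exists>\<^sub>F t in at_right (0 :: real). p + t *\<^sub>R d \<in> S"
  proof (rule ccontr)
    assume "\<not> ?thesis"
    then have "\<forall>\<^sub>F t in at_right (0 :: real). \<forall>S\<in>F. p + t *\<^sub>R d \<notin> S"
      using \<open>finite F\<close> by (simp add: eventually_ball_finite_distrib frequently_def)
    with ev have "\<forall>\<^sub>F t in at_right (0 :: real). False"
      by eventually_elim blast
    then show False by simp
  qed
  then obtain S where S: "S \<in> F" and fr: "\<exists>\<^sub>F t in at_right (0 :: real). p + t *\<^sub>R d \<in> S"
    by blast
  have p: "p \<in> S" using frequently_closed_point F(1) S fr by blast
  have "\<exists>\<^sub>F t in at_right (0 :: real). p + t *\<^sub>R d \<in> S \<and> 0 < t"
    using fr eventually_at_right_less by (rule frequently_eventually_frequently)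
  then obtain h where h: "0 < h" "p + h *\<^sub>R d \<in> S" by (blast dest: frequently_ex)
  have "p + t *\<^sub>R d \<in> S" if "0 < t" "t < h" for t
  proof -
    have "(1 - t / h) *\<^sub>R p + (t / h) *\<^sub>R (p + h *\<^sub>R d) \<in> S"
      using that h p F(2)[OF S] by (intro convexD) auto
    moreover have "(1 - t / h) *\<^sub>R p + (t / h) *\<^sub>R (p + h *\<^sub>R d) = p + t *\<^sub>R d"
      using h(1) by (simp add: algebra_simps)
    ultimately show ?thesis by simp
  qed
  then have "d \<in> germ S p"
    using h(1) by (auto simp: germ_def eventually_at_right_field)
  then show "d \<in> (\<Union>S\<in>F. germ S p)" using S by blast
next
  fix d assume "d \<in> (\<Union>S\<in>F. germ S p)"
  then show "d \<in> germ (\<Union>F) p"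
    by (auto simp: germ_def elim!: eventually_mono)
qed

text \<open>The local angle sum at \<open>p\<close>: germs of different tiles overlap in the germ of
  a set without interior, which is negligible.\<close>

lemma aperture_germ_Union:
  assumes "finite F" and F: "\<And>S. S \<in> F \<Longrightarrow> closed S" "\<And>S. S \<in> F \<Longrightarrow> convex S"
    and disj: "pairwise (\<lambda>S S'. interior S \<inter> interior S' = {}) F"
  shows "aperture (germ (\<Union>F) p) = (\<Sum>S\<in>F. aperture (germ S p))"
proof -
  have "negligible (germ S p \<inter> germ S' p)" if "S \<in> F" "S' \<in> F" "S \<noteq> S'" for S S'
    unfolding germ_Int using that F(2) disj
    by (intro negligible_germ convex_Int) (auto simp: interior_Int pairwise_def)
  then show ?thesis
    using aperture_Union[of F "\<lambda>S. germ S p"] assms(1) F(2) convex_germ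
    by (simp add: germ_Union[OF assms(1) F])
qed

section \<open>Germs of a triangle at its vertices, edge points and interior points\<close>

lemma eventually_at_right_0_nonneg_iff:
  fixes x y :: real
  shows "(\<forall>\<^sub>F t in at_right 0. 0 \<le> x + t * y) \<longleftrightarrow> 0 < x \<or> x = 0 \<and> 0 \<le> y"
proof -
  have lim: "((\<lambda>t. x + t * y) \<longlongrightarrow> x + 0 * y) (at_right 0)"
    by (intro tendsto_intros)
  consider "0 < x" | "x = 0" | "x < 0" by linarith
  then show ?thesis
  proof cases
    case 1
    then have "\<forall>\<^sub>F t in at_right 0. 0 < x + t * y"
      using order_tendstoD(1)[OF lim] by simp
    then show ?thesis using 1 by (auto elim: eventually_mono)
  next
    case 2
    have pos: "\<forall>\<^sub>F t in at_right (0 :: real). 0 < t" by (rule eventually_at_right_less)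
    show ?thesis
    proof (cases "0 \<le> y")
      case True
      then show ?thesis using 2 pos by (auto elim: eventually_mono)
    next
      case False
      have "\<forall>\<^sub>F t in at_right 0. t * y < 0"
        using pos by (rule eventually_mono) (use False in \<open>simp add: mult_pos_neg\<close>)
      moreover have "\<not> (\<forall>\<^sub>F t in at_right (0 :: real). 0 \<le> t * y)"
      proof
        assume "\<forall>\<^sub>F t in at_right (0 :: real). 0 \<le> t * y"
        with \<open>\<forall>\<^sub>F t in at_right 0. t * y < 0\<close> have "\<forall>\<^sub>F t in at_right (0 :: real). False"
          by eventually_elim simp
        then show False by simp
      qed
      ultimately show ?thesis using 2 False by simp
    qed
  next
    case 3
    then have neg: "\<forall>\<^sub>F t in at_right 0. x + t * y < 0"
      using order_tendstoD(2)[OF lim] by simp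
    have "\<not> (\<forall>\<^sub>F t in at_right 0. 0 \<le> x + t * y)"
    proof
      assume "\<forall>\<^sub>F t in at_right 0. 0 \<le> x + t * y"
      with neg have "\<forall>\<^sub>F t in at_right (0 :: real). False"
        by eventually_elim simp
      then show False by simp
    qed
    then show ?thesis using 3 by simp
  qed
qed

lemma mem_triangle_iff:
  fixes a b c :: "real^2"
  assumes "\<not> collinear {a, b, c}"
  shows "a + x *\<^sub>R (b - a) + y *\<^sub>R (c - a) \<in> convex hull {a, b, c} \<longleftrightarrow> 0 \<le> x \<and> 0 \<le> y \<and> x + y \<le> 1"
proof -
  have "cross2 (b - a) (c - a) \<noteq> 0" using assms by (simp add: collinear_iff_cross2)
  note uniq = cramer2_unique[OF this]
  show ?thesis
    unfolding convex_hull_3_alt mem_Collect_eq add.assoc add_left_cancel uniq by blast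
qed

text \<open>Each of the three edge inequalities restricts the direction only if it is tight at the
  base point; a strict one persists for small \<open>t\<close>, and a violated one excludes every
  direction.\<close>

lemma mem_germ_triangle_iff:
  assumes "\<not> collinear {a, b, c}"
  shows "x *\<^sub>R (b - a) + y *\<^sub>R (c - a) \<in> germ (convex hull {a, b, c}) (a + x0 *\<^sub>R (b - a) + y0 *\<^sub>R (c - a))
     \<longleftrightarrow> (0 < x0 \<or> x0 = 0 \<and> 0 \<le> x) \<and> (0 < y0 \<or> y0 = 0 \<and> 0 \<le> y)
       \<and> (x0 + y0 < 1 \<or> x0 + y0 = 1 \<and> x + y \<le> 0)"
proof -
  have *: "a + x0 *\<^sub>R u + y0 *\<^sub>R w + t *\<^sub>R (x *\<^sub>R u + y *\<^sub>R w)
      = a + (x0 + t * x) *\<^sub>R u + (y0 + t * y) *\<^sub>R w" for t and u w :: "real^2"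
    by (simp add: algebra_simps)
  have **: "x0 + t * x + (y0 + t * y) \<le> 1 \<longleftrightarrow> 0 \<le> (1 - x0 - y0) + t * (- x - y)" for t
    by (auto simp: algebra_simps)
  show ?thesis
    unfolding germ_def mem_Collect_eq * mem_triangle_iff[OF assms] **
      eventually_conj_iff eventually_at_right_0_nonneg_iff
    by auto
qed

lemma aperture_germ_vertex:
  assumes "\<not> collinear {a, b, c}"
  shows "aperture (germ (convex hull {a, b, c}) a) = aperture_at b a c"
proof -
  have c: "cross2 (b - a) (c - a) \<noteq> 0" using assms by (simp add: collinear_iff_cross2)
  have "d \<in> germ (convex hull {a, b, c}) a \<longleftrightarrow> d \<in> cone2 (b - a) (c - a)" for d
  proof -
    obtain x y where d: "d = x *\<^sub>R (b - a) + y *\<^sub>R (c - a)" using cramer2E[OF c] by blast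
    then have "d \<in> germ (convex hull {a, b, c}) a \<longleftrightarrow> 0 \<le> x \<and> 0 \<le> y"
      using mem_germ_triangle_iff[OF assms, of x y 0 0] by simp
    also have "\<dots> \<longleftrightarrow> d \<in> cone2 (b - a) (c - a)"
      unfolding d mem_cone2_iff[OF c] ..
    finally show ?thesis .
  qed
  then have "germ (convex hull {a, b, c}) a = cone2 (b - a) (c - a)" by blast
  then show ?thesis by (simp add: aperture_at_def)
qed

text \<open>The germ is the whole plane at an interior point and a half-plane at a point inside an
  edge.\<close>

lemma aperture_germ_nonvertex:
  assumes nc: "\<not> collinear {a, b, c}"
    and p: "p \<in> convex hull {a, b, c}" "p \<notin> {a, b, c}"
  shows "aperture (germ (convex hull {a, b, c}) p) \<in> {1, 2}"
proof -
  define u w where "u = b - a" and "w = c - a"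
  have c: "cross2 u w \<noteq> 0" using nc by (simp add: collinear_iff_cross2 u_def w_def)
  obtain x0 y0 where p0: "p = a + x0 *\<^sub>R u + y0 *\<^sub>R w" and nn: "0 \<le> x0" "0 \<le> y0" "x0 + y0 \<le> 1"
    using p(1) unfolding convex_hull_3_alt u_def w_def by blast
  let ?G = "germ (convex hull {a, b, c}) p"
  have G: "x *\<^sub>R u + y *\<^sub>R w \<in> ?G \<longleftrightarrow> (0 < x0 \<or> x0 = 0 \<and> 0 \<le> x) \<and> (0 < y0 \<or> y0 = 0 \<and> 0 \<le> y)
       \<and> (x0 + y0 < 1 \<or> x0 + y0 = 1 \<and> x + y \<le> 0)" for x y
    using mem_germ_triangle_iff[OF nc, of x y x0 y0] unfolding p0 u_def w_def .
  have eqI: "?G = H" if "\<And>x y. x *\<^sub>R u + y *\<^sub>R w \<in> ?G \<longleftrightarrow> x *\<^sub>R u + y *\<^sub>R w \<in> H" for H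
    using that cramer2E[OF c] by (metis subsetI equalityI)
  have ne: "\<not> (x0 = 0 \<and> y0 = 0)" "\<not> (x0 = 1 \<and> y0 = 0)" "\<not> (x0 = 0 \<and> y0 = 1)"
    using p(2) by (auto simp: p0 u_def w_def)
  consider "0 < x0" "0 < y0" "x0 + y0 < 1" | "x0 = 0" "0 < y0" "y0 < 1" | "y0 = 0" "0 < x0" "x0 < 1"
    | "x0 + y0 = 1" "0 < x0" "0 < y0"
    using nn ne by argo
  then show ?thesis
  proof cases
    case 1
    then have "?G = UNIV" by (intro eqI) (simp add: G)
    then show ?thesis by simp
  next
    case 2
    have c': "cross2 w u \<noteq> 0" using c by (simp add: cross2_commute[of w u])
    have "?G = hplane w u"
    proof (rule eqI)
      fix x y
      have "x *\<^sub>R u + y *\<^sub>R w \<in> hplane w u \<longleftrightarrow> 0 \<le> x"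
        unfolding add.commute[of "x *\<^sub>R u"] by (rule mem_hplane_iff[OF c'])
      then show "x *\<^sub>R u + y *\<^sub>R w \<in> ?G \<longleftrightarrow> x *\<^sub>R u + y *\<^sub>R w \<in> hplane w u"
        using 2 by (simp add: G)
    qed
    then show ?thesis using aperture_hplane(1)[OF c'] by simp
  next
    case 3
    have "?G = hplane u w"
      using 3 by (intro eqI) (simp add: G mem_hplane_iff[OF c])
    then show ?thesis using aperture_hplane(1)[OF c] by simp
  next
    case 4
    have *: "s *\<^sub>R (w - u) + t *\<^sub>R - u = (- s - t) *\<^sub>R u + s *\<^sub>R w" for s t
      by (simp add: algebra_simps)
    \<comment> \<open>Here \<open>w - u\<close> is the direction of the edge from \<open>b\<close>
      to \<open>c\<close>, and \<open>- u\<close> points from \<open>b\<close> to \<open>a\<close>,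
      hence to the inner side.\<close>
    have "?G = hplane (w - u) (- u)"
    proof (rule eqI)
      fix x y
      have "x *\<^sub>R u + y *\<^sub>R w \<in> hplane (w - u) (- u) \<longleftrightarrow> (\<exists>s t. x = - s - t \<and> y = s \<and> 0 \<le> t)"
        unfolding hplane_def * mem_Collect_eq cramer2_unique[OF c] by blast
      also have "\<dots> \<longleftrightarrow> x + y \<le> 0" by (auto intro: exI[of _ "- x - y"])
      finally show "x *\<^sub>R u + y *\<^sub>R w \<in> ?G \<longleftrightarrow> x *\<^sub>R u + y *\<^sub>R w \<in> hplane (w - u) (- u)"
        using 4 by (simp add: G)
    qed
    then show ?thesis using aperture_hplane(1)[of "w - u" "- u"] c cross2_commute[of w u] by simp
  qed
qed

section \<open>Similarities, and comparison of the obtuse angle with 120 degrees\<close>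

lemma aperture_at_orthogonal:
  assumes "orthogonal_transformation f" "0 < c"
    and g: "\<And>x. g x = z + c *\<^sub>R f x"
  shows "aperture_at (g p) (g q) (g r) = aperture_at p q r"
proof -
  have "g x - g y = c *\<^sub>R f (x - y)" for x y
    unfolding g linear_diff[OF orthogonal_transformation_linear[OF assms(1)]]
    by (simp add: scaleR_right_diff_distrib)
  then show ?thesis
    using aperture_cone2_orthogonal[OF assms(1)] cone2_scaleR[OF assms(2) assms(2)]
    by (simp add: aperture_at_def)
qed

text \<open>The labelled vertices of \<open>T\<close> are pulled back by the inverse similarity, so
  that equal letters carry equal angles.\<close>

lemma similar_triangle:
  assumes "similar S T" "triangle_on a b c T"
  obtains a' b' c' where "triangle_on a' b' c' S" "aperture_at b' a' c' = aperture_at b a c"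
    "aperture_at a' b' c' = aperture_at a b c" "aperture_at a' c' b' = aperture_at a c b"
proof -
  obtain f k where k: "0 < k" "\<And>x y. dist (f x) (f y) = k * dist x y" "f ` S = T"
    using assms(1) unfolding similar_def by blast
  \<comment> \<open>Removing the translation and the scale from \<open>f\<close> leaves an isometry
    fixing 0, hence an orthogonal map.\<close>
  define R where "R = (\<lambda>x. inverse k *\<^sub>R (f x - f 0))"
  have "orthogonal_transformation R"
    unfolding orthogonal_transformation_isometry
  proof (intro conjI allI)
    show "R 0 = 0" by (simp add: R_def)
    fix x y
    have "dist (R x) (R y) = norm (inverse k *\<^sub>R (f x - f y))"
      by (simp add: R_def dist_norm algebra_simps)
    also have "\<dots> = dist x y"
      using k(1) k(2)[of x y] by (simp add: dist_norm)
    finally show "dist (R x) (R y) = dist x y" .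
  qed
  then have oQ: "orthogonal_transformation (inv R)" and bij: "bij R"
    by (simp_all add: orthogonal_transformation_inv orthogonal_transformation_bij)
  note linQ = orthogonal_transformation_linear[OF oQ]
  \<comment> \<open>\<open>g\<close> is the inverse of \<open>f\<close>, written as an affine map
    with linear part \<open>inverse k\<close> times an orthogonal map.\<close>
  define g where "g y = inv R (inverse k *\<^sub>R (y - f 0))" for y
  have gf: "g (f x) = x" for x
    using bij by (simp add: g_def R_def[symmetric] fun_cong[OF R_def, symmetric] bij_is_inj)
  have g: "g y = - (inverse k *\<^sub>R inv R (f 0)) + inverse k *\<^sub>R inv R y" for y
    by (simp add: g_def linear_scale[OF linQ] linear_diff[OF linQ] algebra_simps)
  have gd: "g x - g y = inverse k *\<^sub>R inv R (x - y)" for x y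
    by (simp add: g linear_diff[OF linQ] algebra_simps)
  have nc: "\<not> collinear {a, b, c}" and T: "T = convex hull {a, b, c}"
    using assms(2) by (auto simp: triangle_on_def)
  have S: "S = g ` T" using k(3) gf by (force simp: image_iff)
  also have "\<dots> = (\<lambda>x. - (inverse k *\<^sub>R inv R (f 0)) + inverse k *\<^sub>R x) ` inv R ` T"
    by (simp add: image_image g)
  also have "\<dots> = convex hull {g a, g b, g c}"
    unfolding T convex_hull_linear_image[OF linQ] convex_hull_affinity[symmetric]
    by (simp add: g)
  finally have hull: "S = convex hull {g a, g b, g c}" .
  have "\<not> collinear {g a, g b, g c}"
  proof
    assume "collinear {g a, g b, g c}"
    then have "collinear {0, inverse k *\<^sub>R inv R (b - a), inverse k *\<^sub>R inv R (c - a)}"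
      unfolding collinear_iff_cross2 gd by simp
    then have "collinear {0, inv R (b - a), inv R (c - a)}"
      using k(1) unfolding collinear_scaleR_iff by simp
    moreover have "inj (inv R)" by (simp add: oQ orthogonal_transformation_inj)
    then have "inv R x = inv R y \<longleftrightarrow> x = y" for x y by (rule inj_eq)
    then have "inv R x = 0 \<longleftrightarrow> x = 0" "inv R x = t *\<^sub>R inv R y \<longleftrightarrow> x = t *\<^sub>R y" for x y t
      by (metis linear_0[OF linQ], metis linear_scale[OF linQ])
    ultimately have "b - a = 0 \<or> c - a = 0 \<or> (\<exists>t. c - a = t *\<^sub>R (b - a))"
      unfolding collinear_lemma by simp
    then have "collinear {0, b - a, c - a}" unfolding collinear_lemma .
    then show False using nc by (simp add: collinear_iff_cross2)
  qed
  then have "triangle_on (g a) (g b) (g c) S" using hull by (simp add: triangle_on_def)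
  then show ?thesis
    by (rule that; intro aperture_at_orthogonal[OF oQ _ g]) (use k(1) in simp_all)
qed

text \<open>Instead of converting \<open>angle_at\<close> into area in general, the angle is
  compared with one explicit sector of 120 degrees: two of three congruent sectors filling a
  half-plane have aperture 2/3, and the given cone strictly contains their union.\<close>

lemma aperture_obtuse:
  assumes nc: "\<not> collinear {a, b, c}" and ang: "angle_at a b c > 2 * pi / 3"
  shows "aperture_at a b c > 2 / 3"
proof -
  have ne: "a \<noteq> b" "c \<noteq> b" using nc by auto
  define u w where "u = inverse (norm (a - b)) *\<^sub>R (a - b)" and "w = inverse (norm (c - b)) *\<^sub>R (c - b)"
  have nu: "norm u = 1" and nw: "norm w = 1" using ne by (simp_all add: u_def w_def)
  have ap: "aperture_at a b c = aperture (cone2 u w)"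
    unfolding aperture_at_def u_def w_def using ne by (subst cone2_scaleR) auto
  define s where "s = u \<bullet> w"
  define \<sigma> where "\<sigma> = cross2 u w"
  have "\<not> collinear {b, a, c}" using nc by (simp add: insert_commute)
  then have \<sigma>: "\<sigma> \<noteq> 0" using ne
    by (simp add: \<sigma>_def u_def w_def collinear_iff_cross2 del: cross2_simps(8,9))
  have u1: "(u $ 1)\<^sup>2 + (u $ 2)\<^sup>2 = 1" and w1: "(w $ 1)\<^sup>2 + (w $ 2)\<^sup>2 = 1"
    using nu nw unfolding norm_eq_1 inner_vec_def sum_2 by (simp_all add: power2_eq_square)
  have s_eq: "s = u $ 1 * w $ 1 + u $ 2 * w $ 2" by (simp add: s_def inner_vec_def sum_2)
  have "s\<^sup>2 + \<sigma>\<^sup>2 = ((u $ 1)\<^sup>2 + (u $ 2)\<^sup>2) * ((w $ 1)\<^sup>2 + (w $ 2)\<^sup>2)"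
    unfolding s_eq \<sigma>_def cross2_def by (simp add: power2_eq_square algebra_simps)
  \<comment> \<open>\<open>s\<close> is the cosine of the angle and \<open>\<sigma>\<close> its sine
    up to sign.\<close>
  then have s\<sigma>: "s\<^sup>2 + \<sigma>\<^sup>2 = 1" by (simp add: u1 w1)
  have s: "s < - 1 / 2"
  proof (rule ccontr)
    assume "\<not> ?thesis"
    then have "- 1 / 2 \<le> s" by simp
    moreover have "s \<le> 1" using s\<sigma> by (smt (verit) power2_le_imp_le one_power2 zero_le_power2)
    ultimately have "arccos s \<le> arccos (- 1 / 2)" by (intro arccos_le_arccos) auto
    also have "\<dots> = 2 * pi / 3" using arccos_cos[of "2 * pi / 3"] pi_ge_zero
      by (simp add: cos_120)
    finally have "arccos s \<le> 2 * pi / 3" .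
    moreover have "angle_at a b c = arccos s"
      by (simp add: angle_at_def s_def u_def w_def divide_inverse mult.commute mult.left_commute)
    ultimately show False using ang by simp
  qed
  have "(1 / 2)\<^sup>2 < (- s)\<^sup>2" using s by (intro power_strict_mono) auto
  then have "4 * \<sigma>\<^sup>2 < 3" using s\<sigma> by (simp add: power2_eq_square)
  \<comment> \<open>The factor makes \<open>k = \<sigma> * \<rho>\<close> equal to the sine of 60
    degrees in absolute value, with the sign of \<open>\<sigma>\<close>. It is also the coefficient
    of \<open>w\<close> when \<open>e\<close> below is expanded in \<open>u\<close> and
    \<open>w\<close>.\<close>
  define \<rho> where "\<rho> = sqrt (3 / (4 * \<sigma>\<^sup>2))"
  have \<rho>: "1 < \<rho>" using \<open>4 * \<sigma>\<^sup>2 < 3\<close> \<sigma> by (simp add: \<rho>_def)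
  define k where "k = \<sigma> * \<rho>"
  have k: "k\<^sup>2 = 3 / 4" using \<sigma> by (simp add: k_def \<rho>_def power_mult_distrib)
  \<comment> \<open>rotation by 60 degrees towards \<open>w\<close>, so \<open>R\<^sup>2 = R - 1\<close>\<close>
  define R :: "real^2 \<Rightarrow> real^2" where "R d = vector [d $ 1 / 2 - k * d $ 2, d $ 2 / 2 + k * d $ 1]" for d
  have R_simps: "R d $ 1 = d $ 1 / 2 - k * d $ 2" "R d $ 2 = d $ 2 / 2 + k * d $ 1" for d
    by (simp_all add: R_def)
  have oR: "orthogonal_transformation R"
    unfolding orthogonal_transformation
  proof (intro conjI allI)
    show "linear R"
      by (rule linearI) (simp_all add: vec_eq_iff forall_2 R_simps algebra_simps)
    fix v :: "real^2"
    have "(R v $ 1)\<^sup>2 + (R v $ 2)\<^sup>2 = (1 / 4 + k\<^sup>2) * ((v $ 1)\<^sup>2 + (v $ 2)\<^sup>2)"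
      by (simp add: R_simps power2_eq_square algebra_simps)
    also have "1 / 4 + k\<^sup>2 = 1" by (simp add: k)
    finally show "norm (R v) = norm v"
      unfolding norm_eq_sqrt_inner inner_vec_def sum_2 by (simp add: power2_eq_square)
  qed
  have k': "k * (k * x) = 3 / 4 * x" for x
    using k by (simp add: power2_eq_square mult.assoc[symmetric])
  have RR: "R (R d) = R d - d" for d
    by (simp add: vec_eq_iff forall_2 R_simps algebra_simps k') (simp add: field_simps)
  \<comment> \<open>By \<open>RR\<close> this is \<open>R (R u)\<close>, that is, \<open>u\<close>
    rotated by 120 degrees; one more rotation gives \<open>- u\<close>.\<close>
  define e where "e = R u - u"
  have Re: "R e = - u"
    unfolding e_def by (simp add: linear_diff[OF orthogonal_transformation_linear[OF oR]] RR)
  have "cross2 u (R u) = k * ((u $ 1)\<^sup>2 + (u $ 2)\<^sup>2)"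
    by (simp add: cross2_def R_simps power2_eq_square algebra_simps)
  then have cuR: "cross2 u (R u) = k" by (simp add: u1)
  have k0: "k \<noteq> 0" using k by auto
  have "aperture (cone2 u e) + aperture (cone2 e (- u)) = 1"
    using aperture_hplane(2)[of u e] cuR k0 by (simp add: e_def)
  moreover have "aperture (cone2 u e) = aperture (cone2 u (R u)) + aperture (cone2 (R u) e)"
    by (rule aperture_cone2_add[of _ _ 1 1]) (use cuR k0 in \<open>simp_all add: e_def\<close>)
  moreover have "aperture (cone2 (R u) e) = aperture (cone2 u (R u))"
    using aperture_cone2_orthogonal[OF oR, of u "R u"] by (simp add: RR e_def)
  moreover have "aperture (cone2 e (- u)) = aperture (cone2 (R u) e)"
    using aperture_cone2_orthogonal[OF oR, of "R u" e] by (simp add: RR e_def[symmetric] Re)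
  \<comment> \<open>The sectors from \<open>u\<close> to \<open>R u\<close>, from \<open>R u\<close>
    to \<open>e\<close> and from \<open>e\<close> to \<open>- u\<close> are congruent and sum to
    1.\<close>
  ultimately have e: "aperture (cone2 u e) = 2 / 3" by linarith
  have "cross2 (R u) w = \<sigma> / 2 - k * s"
    by (simp add: cross2_def R_simps \<sigma>_def s_eq algebra_simps)
  then have cew: "cross2 e w = - \<sigma> / 2 - k * s" by (simp add: e_def \<sigma>_def)
  have cue: "cross2 u e = k" by (simp add: e_def cuR)
  \<comment> \<open>\<open>e\<close> lies strictly between \<open>u\<close> and \<open>w\<close>:
    its Cramer coefficients are positive because \<open>\<rho> > 1\<close> and
    \<open>- s > 1 / 2\<close>.\<close>
  have "aperture (cone2 u w) = aperture (cone2 u e) + aperture (cone2 e w)"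
  proof (rule aperture_cone2_add)
    show "cross2 u w \<noteq> 0" using \<sigma> by (simp add: \<sigma>_def)
    show "e = (- 1 / 2 - \<rho> * s) *\<^sub>R u + \<rho> *\<^sub>R w"
      using cramer2[OF \<open>cross2 u w \<noteq> 0\<close>, of e] \<sigma>
      by (simp add: cew cue \<sigma>_def[symmetric] k_def diff_divide_distrib)
    have "1 * (1 / 2) < \<rho> * (- s)" using \<rho> s by (intro mult_strict_mono) auto
    then show "0 < - 1 / 2 - \<rho> * s" by simp
    show "0 < \<rho>" using \<rho> by simp
  qed
  moreover have "0 < aperture (cone2 e w)"
  proof (rule aperture_cone2_pos)
    have "cross2 e w = \<sigma> * (- 1 / 2 - \<rho> * s)" by (simp add: cew k_def algebra_simps)
    moreover have "1 * (1 / 2) < \<rho> * (- s)" using \<rho> s by (intro mult_strict_mono) auto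
    ultimately show "cross2 e w \<noteq> 0" using \<sigma> by auto
  qed
  ultimately show ?thesis using e ap by linarith
qed

subsection \<open>Counting angles\<close>

text \<open>Already \<open>m + 1\<close> items would weigh more than \<open>2 * (m + 1) / 3\<close>,
  which is at least \<open>m\<close> as \<open>m \<le> 2\<close>. It serves for the weight \<gamma>
  and for the share of \<beta> in \<alpha> + \<beta>.\<close>

lemma nat_le_of_weight:
  fixes n m :: nat and w :: real
  assumes "w * n \<le> m" "2 / 3 < w" "m = 1 \<or> m = 2"
  shows "n \<le> m"
proof (rule ccontr)
  assume "\<not> n \<le> m"
  then have "real m + 1 \<le> n" by linarith
  then have "w * (real m + 1) \<le> w * n" using assms(2) by (intro mult_left_mono) auto
  then have "w * (real m + 1) \<le> m" using assms(1) by linarith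
  then show False using assms(2,3) by auto
qed

text \<open>The arithmetic core, free of geometry: \<open>na p\<close>, \<open>nb p\<close>,
  \<open>nc p\<close> stand for the numbers of tile angles \<alpha>, \<beta>, \<gamma> with apex
  \<open>p\<close>, and \<open>A\<close>, \<open>B\<close>, \<open>C\<close> for the vertices of the
  tiled triangle with these angles.\<close>

lemma vertex_counting:
  fixes na nb nc m :: "'a \<Rightarrow> nat" and r :: nat and \<alpha> \<beta> \<gamma> :: real
  assumes fin: "finite P" and ABC: "{A, B, C} \<subseteq> P" "A \<noteq> B" "A \<noteq> C" "B \<noteq> C"
    and tot: "(\<Sum>p\<in>P. na p) = r" "(\<Sum>p\<in>P. nb p) = r" "(\<Sum>p\<in>P. nc p) = r"
    and m: "\<And>p. p \<in> P - {A, B, C} \<Longrightarrow> \<alpha> * na p + \<beta> * nb p + \<gamma> * nc p = m p"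
      "\<And>p. p \<in> P - {A, B, C} \<Longrightarrow> m p = 1 \<or> m p = 2"
    and A: "\<alpha> * na A + \<beta> * nb A + \<gamma> * nc A = \<alpha>"
    and B: "\<alpha> * na B + \<beta> * nb B + \<gamma> * nc B = \<beta>"
    and C: "\<alpha> * na C + \<beta> * nb C + \<gamma> * nc C = \<gamma>"
    and ang: "\<alpha> + \<beta> + \<gamma> = 1" "2 / 3 < \<gamma>" "0 < \<alpha>" "\<alpha> \<le> \<beta>"
    and v: "v \<in> {A, B, C}"
  shows "na v + nb v + nc v \<le> 2"
proof (rule ccontr)
  assume "\<not> ?thesis"
  then have three: "3 \<le> na v + nb v + nc v" by simp
  define Q where "Q = P - {A, B, C}"
  have split: "sum f P = sum f Q + f A + f B + f C" for f :: "'a \<Rightarrow> real"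
  proof -
    have "sum f P = sum f Q + sum f {A, B, C}"
      unfolding Q_def using fin ABC by (intro sum.subset_diff) auto
    then show ?thesis using ABC by simp
  qed
  have nn: "0 \<le> \<alpha> * na p" "0 \<le> \<beta> * nb p" "0 \<le> \<gamma> * nc p" for p
    using ang by simp_all
  \<comment> \<open>An angle larger than the available room cannot occur.\<close>
  have zero: "n = 0" if "w * n \<le> z" "z < w" "0 < w" for n :: nat and w z :: real
  proof (rule ccontr)
    assume "n \<noteq> 0"
    then have "w * 1 \<le> w * n" using that by (intro mult_left_mono) auto
    then show False using that by linarith
  qed
  have totr: "(\<Sum>p\<in>P. real (na p)) = r" "(\<Sum>p\<in>P. real (nb p)) = r" "(\<Sum>p\<in>P. real (nc p)) = r"
    using tot by (metis of_nat_sum)+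
  \<comment> \<open>Double counting: summed tile by tile, the angles contribute 1 for each of the
    \<open>r\<close> tiles.\<close>
  have "(\<Sum>p\<in>P. \<alpha> * na p + \<beta> * nb p + \<gamma> * nc p) = \<alpha> * r + \<beta> * r + \<gamma> * r"
    by (simp only: sum.distrib sum_distrib_left[symmetric] totr)
  also have "\<dots> = (\<alpha> + \<beta> + \<gamma>) * r" by (simp only: distrib_right)
  finally have "(\<Sum>p\<in>P. \<alpha> * na p + \<beta> * nb p + \<gamma> * nc p) = r" using ang by simp
  then have "(\<Sum>p\<in>Q. \<alpha> * na p + \<beta> * nb p + \<gamma> * nc p) = real r - 1"
    using split[of "\<lambda>p. \<alpha> * na p + \<beta> * nb p + \<gamma> * nc p"] A B C ang by linarith
  then have summ: "(\<Sum>p\<in>Q. real (m p)) = real r - 1"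
    using m(1) by (simp add: Q_def)
  have ncA: "nc A = 0" using zero[of \<gamma> "nc A" \<alpha>] nn[of A] A ang by linarith
  have ncB: "nc B = 0" using zero[of \<gamma> "nc B" \<beta>] nn[of B] B ang by linarith
  have ncC: "nc C \<le> 1"
  proof (rule ccontr)
    assume "\<not> nc C \<le> 1"
    then have "\<gamma> * 2 \<le> \<gamma> * nc C" using ang by (intro mult_left_mono) auto
    then show False using nn[of C] C ang by linarith
  qed
  have ncm: "nc p \<le> m p" if "p \<in> Q" for p
  proof (rule nat_le_of_weight[OF _ ang(2)])
    show "\<gamma> * nc p \<le> m p" using m(1)[of p] nn[of p] that unfolding Q_def by linarith
  qed (use m(2) that in \<open>auto simp: Q_def\<close>)
  have sumc: "(\<Sum>p\<in>Q. real (nc p)) = real r - nc C"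
    using split[of "\<lambda>p. real (nc p)"] totr ncA ncB by simp
  have "(\<Sum>p\<in>Q. real (nc p)) \<le> (\<Sum>p\<in>Q. real (m p))"
    using ncm by (intro sum_mono) simp
  \<comment> \<open>The points of \<open>Q\<close> admit at most \<open>r - 1\<close> angles
    \<gamma>, so one of the \<open>r\<close> must sit at \<open>C\<close>. This makes the termwise
    bounds \<open>ncm\<close> tight.\<close>
  then have ncC1: "nc C = 1" using sumc summ ncC by linarith
  have "(\<Sum>p\<in>Q. real (m p) - real (nc p)) = 0"
    using summ sumc ncC1 by (simp add: sum_subtractf)
  then have eq: "nc p = m p" if "p \<in> Q" for p
    using sum_nonneg_eq_0_iff[of Q "\<lambda>p. real (m p) - real (nc p)"] ncm fin that
    by (auto simp: Q_def)
  have "\<alpha> * na C + \<beta> * nb C = 0" using C ncC1 by simp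
  then have C0: "na C = 0" "nb C = 0" using nn[of C] ang by (auto simp: add_nonneg_eq_0_iff)
  have vC: "v \<noteq> C" using three C0 ncC1 by auto
  have le: "\<alpha> * (na p + nb p) \<le> \<alpha> * na p + \<beta> * nb p" for p
    using ang mult_right_mono[of \<alpha> \<beta> "real (nb p)"] by (simp add: algebra_simps)
  have vA: "v \<noteq> A"
  proof
    assume [simp]: "v = A"
    have "\<alpha> * 3 \<le> \<alpha> * (na A + nb A)" using three ncA ang by (intro mult_left_mono) auto
    then show False using le[of A] A ncA ang by simp
  qed
  then have vB: "v = B" using vC v by auto
  \<comment> \<open>A single \<beta> would fill \<open>B\<close> and leave no room for \<alpha>, so
    all of the at least three angles would be \<beta>.\<close>
  have nbB: "nb B = 0"
  proof (rule ccontr)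
    assume "nb B \<noteq> 0"
    then have "\<beta> * 1 \<le> \<beta> * nb B" using ang by (intro mult_left_mono) auto
    then have "\<alpha> * na B \<le> 0" using B nn[of B] by linarith
    then have "na B = 0" using ang by (simp add: mult_le_0_iff)
    then have "\<beta> * 3 \<le> \<beta> * nb B" using three ncB vB ang by (intro mult_left_mono) auto
    then show False using B nn[of B] ang by linarith
  qed
  have "\<alpha> * 3 \<le> \<alpha> * na B" using three ncB nbB vB ang by (intro mult_left_mono) auto
  then have \<alpha>\<beta>: "3 * \<alpha> \<le> \<beta>" using B nbB ncB by simp
  have nbA: "nb A = 0" using zero[of \<beta> "nb A" \<alpha>] nn[of A] A ang \<alpha>\<beta> by linarith
  have "nb p \<le> m p" if p: "p \<in> Q" for p
  proof (rule nat_le_of_weight)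
    have "\<alpha> * na p + \<beta> * nb p + \<gamma> * m p = m p" using m(1)[of p] p eq[OF p] by (simp add: Q_def)
    then have "\<beta> * nb p \<le> m p - \<gamma> * m p" using nn[of p] by linarith
    also have "\<dots> = (1 - \<gamma>) * m p" by (simp add: algebra_simps)
    also have "1 - \<gamma> = \<alpha> + \<beta>" using ang by simp
    finally have "\<beta> * nb p \<le> (\<alpha> + \<beta>) * m p" .
    then have "\<beta> * nb p / (\<alpha> + \<beta>) \<le> m p" using ang by (simp add: divide_le_eq mult.commute)
    then show "\<beta> / (\<alpha> + \<beta>) * nb p \<le> m p" by simp
    \<comment> \<open>From \<open>3 * \<alpha> \<le> \<beta>\<close> the quotient is at least
      3/4.\<close>
    show "2 / 3 < \<beta> / (\<alpha> + \<beta>)" using \<alpha>\<beta> ang by (simp add: field_simps)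
  qed (use m(2) p in \<open>auto simp: Q_def\<close>)
  then have "(\<Sum>p\<in>Q. real (nb p)) \<le> (\<Sum>p\<in>Q. real (m p))" by (intro sum_mono) simp
  then show False
    using split[of "\<lambda>p. real (nb p)"] totr summ nbA nbB C0 by simp
qed

section \<open>From a tiling to its angle counts\<close>

lemma triangle_vertices_distinct:
  assumes "triangle_on a b c S"
  shows "a \<noteq> b" "a \<noteq> c" "b \<noteq> c"
  using assms by (auto simp: triangle_on_def insert_commute)

lemma extreme_point_of_triangle_iff:
  assumes "triangle_on a b c S"
  shows "p extreme_point_of S \<longleftrightarrow> p \<in> {a, b, c}"
  using assms extreme_point_of_convex_hull_affine_independent[of "{a, b, c}" p]
  by (simp add: triangle_on_def collinear_3_eq_affine_dependent)

lemma triangle_closed_convex: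
  assumes "triangle_on a b c S"
  shows "closed S" "convex S"
  using assms by (auto simp: triangle_on_def intro!: compact_imp_closed finite_imp_compact_convex_hull)

lemma aperture_germ_triangle_vertex:
  assumes "triangle_on a b c S"
  shows "aperture (germ S a) = aperture_at b a c" "aperture (germ S b) = aperture_at a b c"
    "aperture (germ S c) = aperture_at a c b"
  using assms aperture_germ_vertex[of a b c] aperture_germ_vertex[of b a c] aperture_germ_vertex[of c a b]
  by (simp_all add: triangle_on_def insert_commute)

text \<open>Away from its vertices a tile contributes an integer to the local angle sum, with 0 for
  a point outside, where the germ is empty.\<close>

lemma aperture_germ_triangle_other:
  assumes "triangle_on a b c S" "p \<notin> {a, b, c}"
  shows "aperture (germ S p) \<in> {0, 1, 2}" and "p \<in> S \<Longrightarrow> aperture (germ S p) \<in> {1, 2}"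
proof -
  show *: "aperture (germ S p) \<in> {1, 2}" if "p \<in> S"
    using aperture_germ_nonvertex[of a b c p] assms that by (simp add: triangle_on_def)
  have "germ S p = {}" if "p \<notin> S"
    using germ_outside triangle_closed_convex(1)[OF assms(1)] that by blast
  then show "aperture (germ S p) \<in> {0, 1, 2}" using * by (cases "p \<in> S") auto
qed

text \<open>The local angle sums of the tiling supply the equations of
  \<open>vertex_counting\<close>, whose bound also covers the tiles at \<open>v\<close>, since each
  of them has an angle there.\<close>

lemma gentiling_vertex_bound:
  assumes T: "triangle_on A B C T"
    and \<alpha>: "\<alpha> = aperture_at B A C" and \<beta>: "\<beta> = aperture_at A B C" and \<gamma>: "\<gamma> = aperture_at A C B"
    and ang: "\<alpha> \<le> \<beta>" "2 / 3 < \<gamma>"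
    and tiling: "gentiling r T tiles"
    and v: "v extreme_point_of T"
  shows "card {S \<in> tiles. v \<in> S} \<le> 2"
proof -
  have fin: "finite tiles" and card: "card tiles = r" and sim: "\<And>S. S \<in> tiles \<Longrightarrow> similar S T"
    and disj: "pairwise (\<lambda>S S'. interior S \<inter> interior S' = {}) tiles" and un: "\<Union>tiles = T"
    using tiling by (auto simp: gentiling_def)
  have nc: "\<not> collinear {A, B, C}" using T by (simp add: triangle_on_def)
  \<comment> \<open>The vertices of a tile form one triple, ordered by the angles \<alpha>, \<beta>,
    \<gamma>, so that a single choice labels all tiles.\<close>
  have "\<forall>S\<in>tiles. \<exists>t. triangle_on (fst t) (fst (snd t)) (snd (snd t)) S
      \<and> aperture_at (fst (snd t)) (fst t) (snd (snd t)) = \<alpha>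
      \<and> aperture_at (fst t) (fst (snd t)) (snd (snd t)) = \<beta>
      \<and> aperture_at (fst t) (snd (snd t)) (fst (snd t)) = \<gamma>"
    using similar_triangle[OF sim T] unfolding \<alpha> \<beta> \<gamma> by (metis fst_conv snd_conv)
  then obtain t where t: "\<forall>S\<in>tiles. triangle_on (fst (t S)) (fst (snd (t S))) (snd (snd (t S))) S
      \<and> aperture_at (fst (snd (t S))) (fst (t S)) (snd (snd (t S))) = \<alpha>
      \<and> aperture_at (fst (t S)) (fst (snd (t S))) (snd (snd (t S))) = \<beta>
      \<and> aperture_at (fst (t S)) (snd (snd (t S))) (fst (snd (t S))) = \<gamma>"
    by (rule bchoice[THEN exE])
  define a b c where "a S = fst (t S)" and "b S = fst (snd (t S))" and "c S = snd (snd (t S))" for S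
  have tri: "triangle_on (a S) (b S) (c S) S"
    and apS: "aperture_at (b S) (a S) (c S) = \<alpha>" "aperture_at (a S) (b S) (c S) = \<beta>"
      "aperture_at (a S) (c S) (b S) = \<gamma>" if "S \<in> tiles" for S
    using t that by (simp_all add: a_def b_def c_def)
  note dist = triangle_vertices_distinct[OF tri]
  have pos: "0 < \<alpha>" "0 < \<beta>" "0 < \<gamma>"
    using aperture_at_pos[of B A C] aperture_at_pos[of A B C] aperture_at_pos[of A C B] nc
    by (simp_all add: \<alpha> \<beta> \<gamma> insert_commute)
  have sum1: "\<alpha> + \<beta> + \<gamma> = 1" using aperture_at_sum[OF nc] by (simp add: \<alpha> \<beta> \<gamma>)
  define na nb nc where "na p = card {S \<in> tiles. a S = p}" and "nb p = card {S \<in> tiles. b S = p}"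
    and "nc p = card {S \<in> tiles. c S = p}" for p
  \<comment> \<open>The angle that \<open>S\<close> has at \<open>p\<close> as a vertex, and 0 if
    \<open>p\<close> is no vertex of \<open>S\<close>.\<close>
  define g where "g S p = (if a S = p then \<alpha> else 0) + (if b S = p then \<beta> else 0)
    + (if c S = p then \<gamma> else 0)" for S p
  have sumg: "(\<Sum>S\<in>tiles. g S p) = \<alpha> * na p + \<beta> * nb p + \<gamma> * nc p" for p
  proof -
    have "(\<Sum>S\<in>tiles. if f S = p then w else 0) = w * card {S \<in> tiles. f S = p}" for f and w :: real
      by (simp add: sum.If_cases[OF fin] Int_def)
    then show ?thesis by (simp add: g_def sum.distrib na_def nb_def nc_def)
  qed
  have g_nn: "0 \<le> g S p" for S p using pos by (simp add: g_def)
  have g_vertex: "aperture (germ S p) = g S p" if "S \<in> tiles" "p \<in> {a S, b S, c S}" for S p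
    using that aperture_germ_triangle_vertex[OF tri[OF that(1)]] dist[OF that(1)] apS[OF that(1)]
    by (auto simp: g_def)
  have g_other: "\<exists>j :: nat. aperture (germ S p) = g S p + j" if "S \<in> tiles" for S p
  proof (cases "p \<in> {a S, b S, c S}")
    case True
    then show ?thesis using g_vertex[OF that] by (intro exI[of _ 0]) simp
  next
    case False
    then have "g S p = 0" by (auto simp: g_def)
    moreover have "aperture (germ S p) \<in> {real 0, real 1, real 2}"
      using aperture_germ_triangle_other(1)[OF tri[OF that] False] by simp
    ultimately show ?thesis by auto
  qed
  have total: "aperture (germ T p) = (\<Sum>S\<in>tiles. aperture (germ S p))" for p
    unfolding un[symmetric]
    using fin disj triangle_closed_convex[OF tri] by (intro aperture_germ_Union) auto
  have mem_corner: "p \<in> {a S, b S, c S}" if "S \<in> tiles" "p \<in> S" "p extreme_point_of T" for S p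
  proof -
    have "S \<subseteq> T" using un that(1) by blast
    then have "p extreme_point_of S" using that(2,3) unfolding extreme_point_of_def by blast
    then show ?thesis using extreme_point_of_triangle_iff[OF tri[OF that(1)]] by simp
  qed
  have corner: "\<alpha> * na p + \<beta> * nb p + \<gamma> * nc p = aperture (germ T p)" if "p extreme_point_of T" for p
  proof -
    have "aperture (germ S p) = g S p" if S: "S \<in> tiles" for S
    proof (cases "p \<in> S")
      case True
      then show ?thesis using g_vertex mem_corner \<open>p extreme_point_of T\<close> S by blast
    next
      case False
      then have "p \<notin> {a S, b S, c S}"
        using tri[OF S] hull_subset[of "{a S, b S, c S}" convex] by (auto simp: triangle_on_def)
      moreover have "germ S p = {}"
        using False germ_outside triangle_closed_convex(1)[OF tri[OF S]] by blast
      ultimately show ?thesis by (auto simp: g_def)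
    qed
    then show ?thesis by (simp add: total sumg[symmetric])
  qed
  define P where "P = {A, B, C} \<union> a ` tiles \<union> b ` tiles \<union> c ` tiles"
  have finP: "finite P" using fin by (simp add: P_def)
  \<comment> \<open>The total at \<open>p\<close> is 1 or 2, and tiles not having \<open>p\<close>
    as a vertex take integers away. What remains is a positive integer because \<open>p\<close> is a
    vertex of some tile.\<close>
  have "\<exists>m :: nat. (m = 1 \<or> m = 2) \<and> \<alpha> * na p + \<beta> * nb p + \<gamma> * nc p = real m" if p: "p \<in> P - {A, B, C}" for p
  proof -
    obtain S where S: "S \<in> tiles" "p \<in> {a S, b S, c S}" using p by (auto simp: P_def)
    have "p \<in> S"
      using S tri[OF S(1)] hull_subset[of "{a S, b S, c S}" convex] by (auto simp: triangle_on_def)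
    then have "p \<in> T" using S(1) un by blast
    then have "aperture (germ T p) \<in> {real 1, real 2}"
      using aperture_germ_triangle_other(2)[OF T, of p] p by simp
    then obtain i :: nat where i: "aperture (germ T p) = i" "i = 1 \<or> i = 2" by blast
    have "\<forall>S\<in>tiles. \<exists>j :: nat. aperture (germ S p) = g S p + j" using g_other by blast
    then obtain j :: "(real^2) set \<Rightarrow> nat" where j: "\<forall>S\<in>tiles. aperture (germ S p) = g S p + j S"
      by (rule bchoice[THEN exE])
    have "real i = (\<Sum>S\<in>tiles. g S p + j S)" using total[of p] i(1) j by simp
    also have "\<dots> = (\<Sum>S\<in>tiles. g S p) + real (sum j tiles)" by (simp add: sum.distrib)
    finally have eq: "real i = (\<Sum>S\<in>tiles. g S p) + real (sum j tiles)" .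
    have "0 < g S p" using S(2) pos by (auto simp: g_def)
    then have "0 < (\<Sum>S\<in>tiles. g S p)" using g_nn fin S(1) by (intro sum_pos2)
    then have "sum j tiles < i" and "(\<Sum>S\<in>tiles. g S p) = real (i - sum j tiles)"
      using eq by linarith+
    moreover from this have "i - sum j tiles = 1 \<or> i - sum j tiles = 2" using i(2) by linarith
    ultimately show ?thesis unfolding sumg by blast
  qed
  then obtain m :: "real^2 \<Rightarrow> nat" where m: "\<And>p. p \<in> P - {A, B, C} \<Longrightarrow> m p = 1 \<or> m p = 2"
    "\<And>p. p \<in> P - {A, B, C} \<Longrightarrow> \<alpha> * na p + \<beta> * nb p + \<gamma> * nc p = m p"
    by metis
  \<comment> \<open>Each tile is counted once, at the point \<open>f S\<close>.\<close>
  have count: "(\<Sum>p\<in>P. card {S \<in> tiles. f S = p}) = r" if "f ` tiles \<subseteq> P" for f :: "_ \<Rightarrow> real^2"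
    using sum.group[OF fin finP that, of "\<lambda>_. 1 :: nat"] card by simp
  have "{A, B, C} \<subseteq> P" "a ` tiles \<subseteq> P" "b ` tiles \<subseteq> P" "c ` tiles \<subseteq> P" by (auto simp: P_def)
  have E: "p extreme_point_of T \<longleftrightarrow> p \<in> {A, B, C}" for p
    by (rule extreme_point_of_triangle_iff[OF T])
  have "na v + nb v + nc v \<le> 2"
  proof (rule vertex_counting[where P = P and A = A and B = B and C = C and m = m and r = r])
    show "(\<Sum>p\<in>P. na p) = r" "(\<Sum>p\<in>P. nb p) = r" "(\<Sum>p\<in>P. nc p) = r"
      unfolding na_def nb_def nc_def by (rule count; fact)+
    show "\<alpha> * na A + \<beta> * nb A + \<gamma> * nc A = \<alpha>" "\<alpha> * na B + \<beta> * nb B + \<gamma> * nc B = \<beta>"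
      "\<alpha> * na C + \<beta> * nb C + \<gamma> * nc C = \<gamma>"
      using corner E by (simp_all add: aperture_germ_triangle_vertex[OF T] \<alpha> \<beta> \<gamma>)
  qed (use finP \<open>{A, B, C} \<subseteq> P\<close> triangle_vertices_distinct[OF T] m sum1 ang pos v E in simp_all)
  moreover have "{S \<in> tiles. v \<in> S} \<subseteq> {S \<in> tiles. a S = v} \<union> {S \<in> tiles. b S = v} \<union> {S \<in> tiles. c S = v}"
    using mem_corner v by blast
  then have "card {S \<in> tiles. v \<in> S} \<le> card ({S \<in> tiles. a S = v} \<union> {S \<in> tiles. b S = v} \<union> {S \<in> tiles. c S = v})"
    using fin by (intro card_mono) auto
  then have "card {S \<in> tiles. v \<in> S} \<le> na v + nb v + nc v"
    unfolding na_def nb_def nc_def by (meson card_Un_le add_le_mono order_refl order_trans)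
  ultimately show ?thesis by linarith
qed

theorem theorem11:
  fixes T :: "(real^2) set" and \<phi> :: real and k :: nat
  assumes "is_triangle T"
    and "has_angle T \<phi>" and "\<phi> > 2 * pi / 3"
    and "k \<ge> 3"
  shows "\<not> (\<exists>tiles. splitting_gentiling k T tiles)"
proof
  assume "\<exists>tiles. splitting_gentiling k T tiles"
  then obtain tiles r v where tiling: "gentiling r T tiles" and v: "v extreme_point_of T"
    and k: "card {S \<in> tiles. v \<in> S} = k"
    unfolding splitting_gentiling_def by blast
  obtain A B C where T: "triangle_on A C B T" and \<phi>: "\<phi> = angle_at A C B"
    using assms(2) unfolding has_angle_def by blast
  then have obt: "2 / 3 < aperture_at A C B"
    using aperture_obtuse assms(3) by (simp add: triangle_on_def)
  have T': "triangle_on A B C T" "triangle_on B A C T"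
    using T by (simp_all add: triangle_on_def insert_commute)
  have "card {S \<in> tiles. v \<in> S} \<le> 2"
  \<comment> \<open>Exchanging the labels of the two vertices other than \<open>C\<close> arranges
    \<alpha> \<le> \<beta>.\<close>
  proof (cases "aperture_at B A C \<le> aperture_at A B C")
    case True
    show ?thesis
      by (rule gentiling_vertex_bound[OF T'(1) refl refl refl True obt tiling v])
  next
    case False
    then show ?thesis
      using obt gentiling_vertex_bound[OF T'(2) refl refl refl _ _ tiling v]
      by (simp add: aperture_at_commute[of B C A])
  qed
  then show False using k assms(4) by simp
qed

end
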